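(* Let $I\subseteq\mathbb{R}$ be an interval with interior $I^{\circ}$, let $f:I\to\mathbb{R}$ be differentiable on $I^{\circ}$ and such that $f'\in L[a,b]$, where $a,b\in I$ with $a<b$. If $|f'|^{q}$ is concave on $[a,b]$ for some fixed $q\ge 1$, then for each $x\in[a,b]$, $$\left|\frac{(b-x)f(b)+(x-a)f(a)}{b-a}-\frac{1}{b-a}\int_a^b f(u)\,du\right|\le \frac12\left[\frac{(x-a)^2\left|f'\left(\frac{x+2a}{3}\right)\right|+(b-x)^2\left|f'\left(\frac{x+2b}{3}\right)\right|}{b-a}\right].$$
   Context: $f'\in L[a,b]$ means that $f'$ is (Lebesgue) integrable on $[a,b]$.
   Formalization: If a or b is an endpoint of I, f is also assumed to have a one-sided derivative f' there; otherwise f' is undefined at that point and the claim fails (I=[a,b], f=0 on (a,b], f(a)=1, f'=0, x=b). *)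

theory Defs
  imports "HOL-Analysis.Analysis"
begin

end

theory Submission
  imports Defs
begin

text \<open>
  Integrating by parts, the weighted boundary terms minus the integral of \<open>f\<close> equal the integral of
  \<open>(u - x) f'(u)\<close> over \<open>[a,b]\<close>. Since \<open>t powr (1 / q)\<close> is concave and increasing, concavity of
  \<open>|f'| powr q\<close> passes to \<open>|f'|\<close>. On each of \<open>[a,x]\<close> and \<open>[x,b]\<close> the weight \<open>|u - x|\<close> has its
  barycentre at the point \<open>(x + 2a)/3\<close>, respectively \<open>(x + 2b)/3\<close>, and Jensen's inequality, in the
  form of a supporting line at the barycentre, gives the bound.
\<close>

text \<open>For positive \<open>x\<close> this is \<open>powr_convex\<close>. A chord starting at 0
  is treated separately: there the claim reduces to \<open>t powr q \<le> t\<close> for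
  \<open>0 < t < 1\<close>.\<close>

lemma convex_on_powr_nonneg:
  fixes q :: real
  assumes "q \<ge> 1"
  shows "convex_on {0..} (\<lambda>t. t powr q)"
proof (rule convex_on_linorderI)
  fix t x y :: real
  assume t: "0 < t" "t < 1" and xy: "x \<in> {0..}" "y \<in> {0..}" "x < y"
  show "((1 - t) *\<^sub>R x + t *\<^sub>R y) powr q \<le> (1 - t) * x powr q + t * y powr q"
  proof (cases "x = 0")
    case True
    have "t powr q \<le> t"
      using powr_mono'[of 1 q t] assms t by simp
    then show ?thesis
      using True t xy by (simp add: powr_mult mult_right_mono)
  next
    case False
    then show ?thesis
      using convex_onD[OF powr_convex[OF assms], of t x y] t xy by simp
  qed
qed simp

text \<open>Convexity of \<open>t powr q\<close> bounds the \<open>q\<close>-th power of a chord of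
  \<open>g\<close> by the chord of the \<open>q\<close>-th powers, hence by the \<open>q\<close>-th
  power of \<open>g\<close> at the intermediate point. Strict monotonicity of
  \<open>t powr q\<close> on nonnegative reals then removes the power.\<close>

lemma concave_on_of_powr:
  fixes g :: "'a::real_vector \<Rightarrow> real"
  assumes q: "q \<ge> 1" and g: "concave_on S (\<lambda>y. g y powr q)"
    and nonneg: "\<And>y. y \<in> S \<Longrightarrow> 0 \<le> g y"
  shows "concave_on S g"
  unfolding concave_on_iff
proof (intro conjI ballI allI impI)
  show "convex S"
    using g by (simp add: concave_on_iff)
  fix x y :: 'a and u v :: real
  assume xy: "x \<in> S" "y \<in> S" and uv: "0 \<le> u" "0 \<le> v" "u + v = 1"
  have z: "u *\<^sub>R x + v *\<^sub>R y \<in> S"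
    using \<open>convex S\<close> xy uv by (simp add: convexD)
  have "(u * g x + v * g y) powr q \<le> u * g x powr q + v * g y powr q"
    using convex_on_powr_nonneg[OF q] xy nonneg uv by (simp add: convex_on_def)
  also have "\<dots> \<le> g (u *\<^sub>R x + v *\<^sub>R y) powr q"
    using g xy uv by (simp add: concave_on_iff)
  finally show "u * g x + v * g y \<le> g (u *\<^sub>R x + v *\<^sub>R y)"
    using powr_less_mono2[of q "g (u *\<^sub>R x + v *\<^sub>R y)" "u * g x + v * g y"] nonneg[OF z] q
    by linarith
qed

lemma concave_on_supporting_line:
  fixes g :: "real \<Rightarrow> real"
  assumes "concave_on S g" and "c \<in> interior S"
  obtains k where "\<And>u. u \<in> S \<Longrightarrow> g u \<le> g c + k * (u - c)"
proof -
  have "convex_on S (\<lambda>x. - g x)"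
    using assms(1) by (simp add: concave_on_def)
  \<comment> \<open>The slope \<open>k\<close> is the right derivative of \<open>g\<close> at
    \<open>c\<close>, obtained as the negated infimum of the difference quotients of
    \<open>- g\<close> to the right of \<open>c\<close>.\<close>
  from convex_le_Inf_differential[OF this assms(2)] show ?thesis
    by (intro that[of "- Inf ((\<lambda>t. (- g c - - g t) / (c - t)) ` ({c<..} \<inter> S))"]) force
qed

text \<open>The weight \<open>u - x\<close> vanishes at the endpoint \<open>x\<close> and keeps one
  sign up to the other endpoint \<open>z\<close>. Leaving open which endpoint is \<open>x\<close>
  lets one statement serve both halves of the final interval.\<close>

lemma endpoint_weighted_bound:
  fixes f f' :: "real \<Rightarrow> real"
  assumes "a \<le> b" and x: "x = a \<and> z = b \<or> x = b \<and> z = a"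
    and deriv: "\<And>u. u \<in> {a..b} \<Longrightarrow> (f has_real_derivative f' u) (at u within {a..b})"
    and concave: "concave_on {a..b} (\<lambda>u. \<bar>f' u\<bar>)"
  shows "\<bar>(b - x) * f b - (a - x) * f a - integral {a..b} f\<bar> \<le> (z - x)\<^sup>2 / 2 * \<bar>f' ((x + 2 * z) / 3)\<bar>"
proof (cases "a = b")
  case True
  then show ?thesis using x by auto
next
  case False
  then have ab: "a < b" using \<open>a \<le> b\<close> by simp
  define c where "c = (x + 2 * z) / 3"
  \<comment> \<open>The sign of \<open>u - x\<close> on the interval, so that the weight
    \<open>\<bar>u - x\<bar>\<close> becomes a polynomial with an explicit antiderivative.\<close>
  define s :: real where "s = (if x = a then 1 else - 1)"
  have s: "\<bar>u - x\<bar> = s * (u - x)" if "u \<in> {a..b}" for u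
    using that x ab by (auto simp: s_def)
  have "c \<in> interior {a..b}"
    using x ab by (auto simp: c_def)
  then obtain k where k: "\<And>u. u \<in> {a..b} \<Longrightarrow> \<bar>f' u\<bar> \<le> \<bar>f' c\<bar> + k * (u - c)"
    using concave_on_supporting_line[OF concave] by blast
  have cont: "continuous_on {a..b} f"
    using deriv by (rule DERIV_continuous_on)
  define F where "F t = integral {a..t} f" for t
  \<comment> \<open>Integration by parts: subtracting \<open>F\<close> cancels the term
    \<open>f u\<close> in the derivative of \<open>(u - x) * f u\<close>.\<close>
  have "((\<lambda>u. (u - x) * f' u) has_integral ((b - x) * f b - F b) - ((a - x) * f a - F a)) {a..b}"
  proof (rule fundamental_theorem_of_calculus[OF \<open>a \<le> b\<close>])
    fix u assume u: "u \<in> {a..b}"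
    show "((\<lambda>t. (t - x) * f t - F t) has_vector_derivative (u - x) * f' u) (at u within {a..b})"
      unfolding F_def has_real_derivative_iff_has_vector_derivative[symmetric]
      by (rule derivative_eq_intros deriv[OF u] integral_has_real_derivative[OF cont u] refl)+ simp
  qed
  then have parts: "((\<lambda>u. (u - x) * f' u) has_integral
      (b - x) * f b - (a - x) * f a - integral {a..b} f) {a..b}"
    by (simp add: F_def algebra_simps)
  \<comment> \<open>Antiderivative of the weight times the supporting line, found by writing
    \<open>u - c = (u - x) + (x - c)\<close>.\<close>
  define P where "P u = s * (\<bar>f' c\<bar> * (u - x)\<^sup>2 / 2
      + k * ((u - x) ^ 3 / 3 + (x - c) * (u - x)\<^sup>2 / 2))" for u
  have moment: "((\<lambda>u. s * (u - x) * (\<bar>f' c\<bar> + k * (u - c))) has_integral P b - P a) {a..b}"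
  proof (rule fundamental_theorem_of_calculus[OF \<open>a \<le> b\<close>])
    fix u
    show "(P has_vector_derivative s * (u - x) * (\<bar>f' c\<bar> + k * (u - c))) (at u within {a..b})"
      unfolding P_def has_real_derivative_iff_has_vector_derivative[symmetric]
      by (auto intro!: derivative_eq_intros simp: field_simps power2_eq_square)
  qed
  have "P x = 0"
    by (simp add: P_def)
  moreover have "P z = s * (z - x)\<^sup>2 / 2 * \<bar>f' c\<bar>"
  proof -
    \<comment> \<open>Here the choice of \<open>c\<close> as barycentre matters: the coefficient of
      the unknown slope \<open>k\<close> in \<open>P z\<close> vanishes.\<close>
    have "x - c = - 2 / 3 * (z - x)"
      by (simp add: c_def field_simps)
    then have "(z - x) ^ 3 / 3 + (x - c) * (z - x)\<^sup>2 / 2 = 0"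
      by (simp add: power2_eq_square power3_eq_cube)
    then show ?thesis by (simp add: P_def)
  qed
  \<comment> \<open>When \<open>x = b\<close>, the difference is \<open>- P z\<close>, and
    \<open>s = - 1\<close> restores the sign.\<close>
  ultimately have "P b - P a = (z - x)\<^sup>2 / 2 * \<bar>f' c\<bar>"
    using x ab by (auto simp: s_def)
  moreover have "\<bar>(u - x) * f' u\<bar> \<le> s * (u - x) * (\<bar>f' c\<bar> + k * (u - c))" if "u \<in> {a..b}" for u
    using mult_left_mono[OF k[OF that], of "\<bar>u - x\<bar>"] s[OF that] by (simp add: abs_mult)
  ultimately show ?thesis
    using integral_norm_bound_integral[OF has_integral_integrable[OF parts] has_integral_integrable[OF moment]]
      integral_unique[OF parts] integral_unique[OF moment]
    by (simp add: c_def)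
qed

theorem theorem7:
  fixes I :: "real set" and f f' :: "real \<Rightarrow> real" and a b q x :: real
  assumes "is_interval I"
    and "a \<in> I" and "b \<in> I" and "a < b"
    and "\<And>y. y \<in> interior I \<Longrightarrow> (f has_real_derivative f' y) (at y)"
    and "\<And>y. y \<in> {a..b} \<Longrightarrow> (f has_real_derivative f' y) (at y within I)"
    and "f' absolutely_integrable_on {a..b}"
    and "q \<ge> 1"
    and "concave_on {a..b} (\<lambda>y. \<bar>f' y\<bar> powr q)"
    and "x \<in> {a..b}"
  shows "\<bar>((b - x) * f b + (x - a) * f a) / (b - a) - 1 / (b - a) * integral {a..b} f\<bar>
    \<le> 1 / 2 * (((x - a)\<^sup>2 * \<bar>f' ((x + 2 * a) / 3)\<bar> + (b - x)\<^sup>2 * \<bar>f' ((x + 2 * b) / 3)\<bar>) / (b - a))"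
proof -
  have xab: "a \<le> x" "x \<le> b" using \<open>x \<in> {a..b}\<close> by auto
  have "{a..b} \<subseteq> I"
    using \<open>is_interval I\<close> \<open>a \<in> I\<close> \<open>b \<in> I\<close> by (meson atLeastAtMost_iff mem_is_interval_1_I subsetI)
  then have deriv: "(f has_real_derivative f' u) (at u within {a..b})" if "u \<in> {a..b}" for u
    using assms(6)[OF that] by (rule DERIV_subset[rotated])
  have "concave_on {a..b} (\<lambda>u. \<bar>f' u\<bar>)"
    using concave_on_of_powr[OF \<open>q \<ge> 1\<close> assms(9)] by simp
  then have concave: "concave_on {l..r} (\<lambda>u. \<bar>f' u\<bar>)" if "{l..r} \<subseteq> {a..b}" for l r
    using that unfolding concave_on_def by (rule convex_on_subset) simp
  \<comment> \<open>On \<open>{a..x}\<close> the weight vanishes at the right end, so only the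
    boundary term at \<open>a\<close> survives; on \<open>{x..b}\<close> only the one at
    \<open>b\<close> does.\<close>
  have left: "\<bar>(x - a) * f a - integral {a..x} f\<bar> \<le> (x - a)\<^sup>2 / 2 * \<bar>f' ((x + 2 * a) / 3)\<bar>"
    using endpoint_weighted_bound[of a x x a f f'] xab concave[of a x]
      DERIV_subset[OF deriv, of _ "{a..x}"]
    by (simp add: power2_commute algebra_simps)
  have right: "\<bar>(b - x) * f b - integral {x..b} f\<bar> \<le> (b - x)\<^sup>2 / 2 * \<bar>f' ((x + 2 * b) / 3)\<bar>"
    using endpoint_weighted_bound[of x b x b f f'] xab concave[of x b]
      DERIV_subset[OF deriv, of _ "{x..b}"]
    by simp
  have "continuous_on {a..b} f"
    using deriv by (rule DERIV_continuous_on)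
  then have "integral {a..b} f = integral {a..x} f + integral {x..b} f"
    using Henstock_Kurzweil_Integration.integral_combine[OF xab integrable_continuous_interval, of f]
    by simp
  then have "\<bar>(b - x) * f b + (x - a) * f a - integral {a..b} f\<bar>
      \<le> \<bar>(x - a) * f a - integral {a..x} f\<bar> + \<bar>(b - x) * f b - integral {x..b} f\<bar>"
    by linarith
  also have "\<dots> \<le> 1 / 2 * ((x - a)\<^sup>2 * \<bar>f' ((x + 2 * a) / 3)\<bar> + (b - x)\<^sup>2 * \<bar>f' ((x + 2 * b) / 3)\<bar>)"
    using add_mono[OF left right] by (simp add: add_divide_distrib)
  finally have "\<bar>(b - x) * f b + (x - a) * f a - integral {a..b} f\<bar>
      \<le> 1 / 2 * ((x - a)\<^sup>2 * \<bar>f' ((x + 2 * a) / 3)\<bar> + (b - x)\<^sup>2 * \<bar>f' ((x + 2 * b) / 3)\<bar>)" .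
  then have "\<bar>(b - x) * f b + (x - a) * f a - integral {a..b} f\<bar> / (b - a)
      \<le> 1 / 2 * ((x - a)\<^sup>2 * \<bar>f' ((x + 2 * a) / 3)\<bar> + (b - x)\<^sup>2 * \<bar>f' ((x + 2 * b) / 3)\<bar>) / (b - a)"
    using \<open>a < b\<close> by (intro divide_right_mono) simp_all
  then show ?thesis
    using \<open>a < b\<close> by (simp add: diff_divide_distrib[symmetric] abs_divide)
qed

end
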